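(* For all $n\ge1$ and $0\le k\le n$, $$P_{0,k,2n+1}=(k+1)\binom{n}{k}\binom{n+1}{k+1}(n!)^2=(n+1)\binom{n}{k}^2(n!)^2$$ and $$P_{1,k,2n+1}=\frac{(n+1)(n-k)}{k+1}\binom{n}{k}^2(n!)^2.$$
   Context: $\mathcal{S}_m$ denotes the set of permutations $\sigma=\sigma_1\cdots\sigma_m$ of $\{1,\dots,m\}$. $\overrightarrow{des}_E(\sigma)$ is the number of indices $i\in\{1,\dots,m-1\}$ with $\sigma_i>\sigma_{i+1}$ and $\sigma_{i+1}$ even. For $j\in\{0,1\}$, $P_{j,k,m}$ is the number of $\sigma\in\mathcal{S}_m$ with $\overrightarrow{des}_E(\sigma)=k$ such that $\sigma_1$ is even if $j=1$ and $\sigma_1$ is odd if $j=0$. *)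

theory Defs
  imports Complex_Main "HOL-Combinatorics.Multiset_Permutations"
begin

text \<open>Permutations \<open>\<sigma>\<^sub>1 \<dots> \<sigma>\<^sub>m\<close> are words, i.e. elements of \<^term>\<open>permutations_of_set {1..m}\<close>.
  List positions start at 0, so \<open>\<sigma> ! i\<close> is \<open>\<sigma>\<^sub>i\<^sub>+\<^sub>1\<close>.\<close>

definition des_E :: "nat list \<Rightarrow> nat" where
  "des_E \<sigma> = card {i. Suc i < length \<sigma> \<and> \<sigma> ! i > \<sigma> ! Suc i \<and> even (\<sigma> ! Suc i)}"

text \<open>The first index \<open>j\<close> of \<open>P\<close> is only meant to take the values 0 and 1.\<close>

definition P :: "nat \<Rightarrow> nat \<Rightarrow> nat \<Rightarrow> nat" where
  "P j k m = card {\<sigma> \<in> permutations_of_set {1..m}. des_E \<sigma> = k \<and>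
     (j = 1 \<longrightarrow> even (\<sigma> ! 0)) \<and> (j = 0 \<longrightarrow> odd (\<sigma> ! 0))}"

end

theory Submission
  imports Defs
begin

text \<open>Insert the letter \<open>m + 1\<close>, larger than all others, into a word \<open>\<sigma>\<close> on \<open>{1..m}\<close>. Wherever
  it is placed it is not the bottom of a descent, so \<open>des_E\<close> grows by one if the
  letter that follows it is even and was not yet a descent bottom, and is unchanged otherwise.
  There are \<open>m div 2\<close> even letters, and those not in first position are bottoms of either an
  ascent or a descent; hence the number of slots of each kind depends only on \<open>des_E \<sigma>\<close> and the
  parity of \<open>\<sigma>\<^sub>1\<close>. The resulting recurrence in \<open>m\<close> is solved by products of two binomial
  coefficients, for odd and even \<open>m\<close> simultaneously.\<close>

section \<open>Inserting a new letter into a word\<close>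

definition insert_at :: "nat \<Rightarrow> 'a \<Rightarrow> 'a list \<Rightarrow> 'a list" where
  "insert_at i y xs = take i xs @ y # drop i xs"

lemma insert_at_0 [simp]: "insert_at 0 y xs = y # xs"
  by (simp add: insert_at_def)

lemma insert_at_Suc [simp]: "insert_at (Suc i) y (x # xs) = x # insert_at i y xs"
  by (simp add: insert_at_def)

lemma set_insert_at [simp]: "set (insert_at i y xs) = insert y (set xs)"
  unfolding insert_at_def by (metis append_take_drop_id list.simps(15) set_append Un_insert_right)

lemma distinct_insert_at:
  "distinct (insert_at i y xs) \<longleftrightarrow> distinct xs \<and> y \<notin> set xs"
proof -
  have "mset (insert_at i y xs) = mset (y # xs)"
    unfolding insert_at_def
    by (metis append_take_drop_id mset.simps(2) mset_append union_mset_add_mset_right)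
  then show ?thesis
    by (metis distinct.simps(2) mset_eq_imp_distinct_iff)
qed

text \<open>Since \<open>y\<close> occurs in neither word, its only occurrence in the common result
  marks where to cut; the two halves then agree.\<close>

lemma insert_at_inject:
  assumes "y \<notin> set xs" "y \<notin> set xs'" "i \<le> length xs" "i' \<le> length xs'"
    and "insert_at i y xs = insert_at i' y xs'"
  shows "xs = xs' \<and> i = i'"
proof -
  have "y \<notin> set (take i xs)" "y \<notin> set (take i' xs')" "y \<notin> set (drop i xs)" "y \<notin> set (drop i' xs')"
    using assms by (auto dest: in_set_takeD in_set_dropD)
  then have eq: "take i xs = take i' xs'" "drop i xs = drop i' xs'"
    using assms(5) unfolding insert_at_def by (auto simp: append_Cons_eq_iff)
  then have "xs = xs'"
    by (metis append_take_drop_id)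
  moreover have "i = i'"
    using arg_cong[OF eq(1), of length] assms(3,4) by simp
  ultimately show ?thesis by simp
qed

lemma permutations_of_set_insert_at:
  assumes "finite A" "y \<notin> A"
  shows "permutations_of_set (insert y A) =
    (\<lambda>(xs, i). insert_at i y xs) ` (permutations_of_set A \<times> {..card A})"
proof (intro equalityI subsetI)
  fix ys assume ys: "ys \<in> permutations_of_set (insert y A)"
  then have "y \<in> set ys" by (simp add: permutations_of_set_def)
  then obtain us vs where split: "ys = us @ y # vs"
    by (meson split_list)
  have "us @ vs \<in> permutations_of_set A"
    using ys assms(2) unfolding split permutations_of_set_def by auto
  moreover from this have "length us \<le> card A"
    by (metis length_finite_permutations_of_set le_add1 length_append)
  moreover have "ys = insert_at (length us) y (us @ vs)"
    by (simp add: split insert_at_def)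
  ultimately show "ys \<in> (\<lambda>(xs, i). insert_at i y xs) ` (permutations_of_set A \<times> {..card A})"
    by (intro image_eqI[where x = "(us @ vs, length us)"]) auto
next
  fix ys assume "ys \<in> (\<lambda>(xs, i). insert_at i y xs) ` (permutations_of_set A \<times> {..card A})"
  then show "ys \<in> permutations_of_set (insert y A)"
    using assms(2) by (auto simp: permutations_of_set_def distinct_insert_at)
qed

text \<open>Deleting \<open>y\<close> and recording its position inverts the insertion, so the words
  on \<open>insert y A\<close> are fibred over those on \<open>A\<close>, each fibre being the
  \<open>card A + 1\<close> slots of one word.\<close>

lemma card_permutations_of_set_insert_at:
  assumes "finite A" "y \<notin> A"
  shows "card {ys \<in> permutations_of_set (insert y A). Q ys} =
    (\<Sum>xs \<in> permutations_of_set A. card {i. i \<le> card A \<and> Q (insert_at i y xs)})"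
proof -
  let ?f = "\<lambda>(xs, i). insert_at i y xs"
  let ?S = "SIGMA xs : permutations_of_set A. {i. i \<le> card A \<and> Q (insert_at i y xs)}"
  have "{ys \<in> permutations_of_set (insert y A). Q ys} = ?f ` ?S"
    unfolding permutations_of_set_insert_at[OF assms] by auto
  moreover have "inj_on ?f ?S"
  proof (rule inj_onI, clarify)
    fix xs i xs' i'
    assume "xs \<in> permutations_of_set A" "xs' \<in> permutations_of_set A"
      and "i \<le> card A" "i' \<le> card A" and "insert_at i y xs = insert_at i' y xs'"
    moreover from this have "y \<notin> set xs" "y \<notin> set xs'"
      using assms(2) by (auto simp: permutations_of_set_def)
    ultimately show "xs = xs' \<and> i = i'"
      by (intro insert_at_inject[of y])
        (auto simp: length_finite_permutations_of_set)
  qed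
  ultimately show ?thesis
    by (simp add: card_image)
qed

section \<open>Even descents and ascents, and the effect of a new maximum\<close>

lemma des_E_Nil [simp]: "des_E [] = 0" and des_E_singleton [simp]: "des_E [x] = 0"
  by (simp_all add: des_E_def)

lemma des_E_Cons_Cons [simp]:
  "des_E (x # y # xs) = of_bool (x > y \<and> even y) + des_E (y # xs)"
proof -
  let ?D = "\<lambda>\<sigma> :: nat list. {i. Suc i < length \<sigma> \<and> \<sigma> ! i > \<sigma> ! Suc i \<and> even (\<sigma> ! Suc i)}"
  have "?D (x # y # xs) = (if x > y \<and> even y then {0} else {}) \<union> Suc ` ?D (y # xs)"
    (is "?L = ?R")
  proof (intro set_eqI)
    fix i show "i \<in> ?L \<longleftrightarrow> i \<in> ?R" by (cases i) auto
  qed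
  moreover have "finite (?D (y # xs))"
    by (rule finite_subset[of _ "{..<length (y # xs)}"]) auto
  ultimately show ?thesis
    unfolding des_E_def by (auto simp: card_insert_if card_image)
qed

text \<open>A set of positions rather than a number, because an individual slot has to be tested for
  membership. Position \<open>i\<close> stands for the gap between \<open>\<sigma> ! i\<close> and
  \<open>\<sigma> ! Suc i\<close>.\<close>

definition asc_E :: "nat list \<Rightarrow> nat set" where
  "asc_E \<sigma> = {i. Suc i < length \<sigma> \<and> \<sigma> ! i < \<sigma> ! Suc i \<and> even (\<sigma> ! Suc i)}"

lemma finite_asc_E [simp]: "finite (asc_E \<sigma>)"
  by (rule finite_subset[of _ "{..<length \<sigma>}"]) (auto simp: asc_E_def)

text \<open>The pair at gap \<open>i\<close> is replaced by an ascent to \<open>M\<close> and a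
  descent from \<open>M\<close>. An even letter after the gap is thus a descent bottom afterwards,
  which is a gain exactly if it was an ascent top before. For the last \<open>i\<close> nothing
  follows \<open>M\<close>, in agreement with \<open>i \<notin> asc_E \<sigma>\<close>.\<close>

lemma des_E_insert_at_Suc:
  assumes "i < length \<sigma>" "distinct \<sigma>" "\<And>x. x \<in> set \<sigma> \<Longrightarrow> x < M"
  shows "des_E (insert_at (Suc i) M \<sigma>) = des_E \<sigma> + of_bool (i \<in> asc_E \<sigma>)"
  using assms
proof (induction \<sigma> arbitrary: i rule: induct_list012)
  case 1
  then show ?case by simp
next
  case (2 x)
  then show ?case by (simp add: asc_E_def insert_at_def)
next
  case (3 x y zs)
  show ?case
  proof (cases i)
    case 0
    have "x < M" "y < M" using "3.prems" by simp_all
    with 0 show ?thesis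
      using "3.prems"(2) by (auto simp: asc_E_def)
  next
    case (Suc i')
    have "des_E (insert_at (Suc i') M (y # zs)) = des_E (y # zs) + of_bool (i' \<in> asc_E (y # zs))"
      using "3.prems" Suc by (intro "3.IH"(2)) auto
    then show ?thesis
      using Suc by (simp add: asc_E_def)
  qed
qed

text \<open>Each even letter is either the first letter, a descent bottom or an ascent top. This
  turns the size of \<open>asc_E \<sigma>\<close> into a function of \<open>des_E \<sigma>\<close>
  and the parity of the first letter.\<close>

lemma des_E_plus_card_asc_E:
  assumes "distinct \<sigma>" "\<sigma> \<noteq> []"
  shows "of_bool (even (\<sigma> ! 0)) + des_E \<sigma> + card (asc_E \<sigma>) = card {x \<in> set \<sigma>. even x}"
proof -
  let ?D = "{i. Suc i < length \<sigma> \<and> \<sigma> ! i > \<sigma> ! Suc i \<and> even (\<sigma> ! Suc i)}"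
  let ?E = "{i. Suc i < length \<sigma> \<and> even (\<sigma> ! Suc i)}"
  have "?E = ?D \<union> asc_E \<sigma>"
    using assms(1) by (auto simp: asc_E_def distinct_conv_nth) (metis Suc_lessD linorder_neqE_nat n_not_Suc_n)
  moreover have "?D \<inter> asc_E \<sigma> = {}"
    by (auto simp: asc_E_def)
  moreover have "finite ?D"
    by (rule finite_subset[of _ "{..<length \<sigma>}"]) auto
  ultimately have E: "card ?E = des_E \<sigma> + card (asc_E \<sigma>)"
    unfolding des_E_def by (simp add: card_Un_disjoint)
  \<comment> \<open>Indices in \<open>?E\<close> point one place before the even letter, hence the
    shift by \<open>Suc\<close>; position 0 has no predecessor and is added by hand.\<close>
  have I: "{i. i < length \<sigma> \<and> even (\<sigma> ! i)} = (if even (\<sigma> ! 0) then {0} else {}) \<union> Suc ` ?E"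
    (is "?L = ?R")
  proof (intro set_eqI)
    fix i show "i \<in> ?L \<longleftrightarrow> i \<in> ?R" using assms(2) by (cases i) auto
  qed
  have "{x \<in> set \<sigma>. even x} = (!) \<sigma> ` ?L"
    by (auto simp: in_set_conv_nth)
  moreover have "inj_on ((!) \<sigma>) ?L"
    using assms(1) by (auto intro!: inj_onI simp: nth_eq_iff_index_eq)
  ultimately have "card {x \<in> set \<sigma>. even x} = card ?L"
    by (simp add: card_image)
  also have "\<dots> = of_bool (even (\<sigma> ! 0)) + card ?E"
  proof -
    have "finite ?E"
      by (rule finite_subset[of _ "{..<length \<sigma>}"]) auto
    then show ?thesis
      unfolding I by (auto simp: card_insert_if card_image)
  qed
  finally show ?thesis using E by simp
qed

lemma card_even_atLeastAtMost: "card {x \<in> {1..m}. even x} = m div 2"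
proof (induction m)
  case 0
  then show ?case by simp
next
  case (Suc m)
  have "{x \<in> {1..Suc m}. even x} =
    (if even (Suc m) then insert (Suc m) {x \<in> {1..m}. even x} else {x \<in> {1..m}. even x})"
    by (auto simp: le_Suc_eq)
  then show ?case
    using Suc by (auto simp: card_insert_if)
qed

section \<open>The recurrence in the length of the word\<close>

definition num_perms :: "bool \<Rightarrow> nat \<Rightarrow> nat \<Rightarrow> nat" where
  "num_perms b k m = card {\<sigma> \<in> permutations_of_set {1..m}. des_E \<sigma> = k \<and> even (\<sigma> ! 0) = b}"

lemma P_eq_num_perms: "P 0 k m = num_perms False k m" "P 1 k m = num_perms True k m"
  by (simp_all add: P_def num_perms_def)

text \<open>The first summand is the front slot, where the new first letter is \<open>Suc m\<close>
  and a descent is gained iff the old first letter is even. The other two are the later slots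
  outside and inside \<open>asc_E \<sigma>\<close>, which keep the first letter. Their numbers are
  written in terms of \<open>k\<close> and \<open>b\<close> instead of \<open>\<sigma>\<close>, so
  that they can be pulled out of a sum over \<open>\<sigma>\<close>.\<close>

lemma card_insertion_slots:
  assumes \<sigma>: "\<sigma> \<in> permutations_of_set {1..m}" and "m \<ge> 1"
  shows "int (card {i. i \<le> m \<and> des_E (insert_at i (Suc m) \<sigma>) = k
        \<and> even (insert_at i (Suc m) \<sigma> ! 0) = b}) =
    of_bool (even (Suc m) = b) *
      (of_bool (des_E \<sigma> = k \<and> even (\<sigma> ! 0) = False)
       + of_bool (Suc (des_E \<sigma>) = k \<and> even (\<sigma> ! 0) = True))
    + (int m - (int (m div 2) - int k - of_bool b)) * of_bool (des_E \<sigma> = k \<and> even (\<sigma> ! 0) = b)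
    + (int (m div 2) - int k + 1 - of_bool b) * of_bool (Suc (des_E \<sigma>) = k \<and> even (\<sigma> ! 0) = b)"
proof -
  have set: "set \<sigma> = {1..m}" and dist: "distinct \<sigma>"
    using \<sigma> by (auto simp: permutations_of_set_def)
  have len: "length \<sigma> = m"
    using set dist distinct_card[of \<sigma>] by simp
  then obtain x xs where Cons: "\<sigma> = x # xs"
    using \<open>m \<ge> 1\<close> by (cases \<sigma>) auto
  have asc: "of_bool (even (\<sigma> ! 0)) + des_E \<sigma> + card (asc_E \<sigma>) = m div 2"
    using des_E_plus_card_asc_E[OF dist] Cons
    unfolding set card_even_atLeastAtMost by blast
  have x: "x \<le> m" using set Cons by auto
  have front: "des_E (insert_at 0 (Suc m) \<sigma>) = des_E \<sigma> + of_bool (even (\<sigma> ! 0))"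
    using x by (simp add: Cons)
  have later: "des_E (insert_at (Suc i) (Suc m) \<sigma>) = des_E \<sigma> + of_bool (i \<in> asc_E \<sigma>)"
    if "i < m" for i
    using that len dist set by (intro des_E_insert_at_Suc) auto
  have asc_sub: "asc_E \<sigma> \<subseteq> {..<m}"
    using len by (auto simp: asc_E_def)
  let ?S = "{i. i \<le> m \<and> des_E (insert_at i (Suc m) \<sigma>) = k \<and> even (insert_at i (Suc m) \<sigma> ! 0) = b}"
  let ?T = "{i. i < m \<and> des_E \<sigma> + of_bool (i \<in> asc_E \<sigma>) = k \<and> even (\<sigma> ! 0) = b}"
  let ?F = "even (Suc m) = b \<and> des_E \<sigma> + of_bool (even (\<sigma> ! 0)) = k"
  have "?S = (if ?F then {0} else {}) \<union> Suc ` ?T" (is "_ = ?R")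
  proof (intro set_eqI)
    fix i show "i \<in> ?S \<longleftrightarrow> i \<in> ?R"
    proof (cases i)
      case 0
      then show ?thesis using front by auto
    next
      case (Suc i')
      have "insert_at (Suc i') (Suc m) \<sigma> ! 0 = \<sigma> ! 0" by (simp add: Cons)
      then show ?thesis using later[of i'] Suc by (auto simp: image_iff Suc_le_eq)
    qed
  qed
  then have S: "card ?S = of_bool ?F + card ?T"
    by (auto simp: card_insert_if card_image)
  \<comment> \<open>For a given word only one kind of slot reaches \<open>k\<close>: the neutral
    ones if \<open>des_E \<sigma> = k\<close>, the gaining ones if \<open>des_E \<sigma>\<close> is
    one less.\<close>
  have T: "?T = (if even (\<sigma> ! 0) = b \<and> des_E \<sigma> = k then {..<m} - asc_E \<sigma>
      else if even (\<sigma> ! 0) = b \<and> Suc (des_E \<sigma>) = k then asc_E \<sigma> else {})"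
    using asc_sub by auto
  have "card ({..<m} - asc_E \<sigma>) = m - card (asc_E \<sigma>)" "card (asc_E \<sigma>) \<le> m"
    using asc_sub card_mono[OF _ asc_sub] by (simp_all add: card_Diff_subset)
  moreover have "int (card (asc_E \<sigma>)) = int (m div 2) - int (des_E \<sigma>) - of_bool (even (\<sigma> ! 0))"
    using asc by (simp flip: asc)
  ultimately show ?thesis
    unfolding S T by auto
qed

lemma num_perms_Suc:
  assumes "m \<ge> 1"
  shows "int (num_perms b k (Suc m)) =
    of_bool (even (Suc m) = b) *
      (int (num_perms False k m) + (case k of 0 \<Rightarrow> 0 | Suc l \<Rightarrow> int (num_perms True l m)))
    + (int m - (int (m div 2) - int k - of_bool b)) * int (num_perms b k m)
    + (int (m div 2) - int k + 1 - of_bool b) *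
        (case k of 0 \<Rightarrow> 0 | Suc l \<Rightarrow> int (num_perms b l m))"
proof -
  let ?A = "permutations_of_set {1..m}"
  have same: "(\<Sum>\<sigma>\<in>?A. of_bool (des_E \<sigma> = k \<and> even (\<sigma> ! 0) = c)) = int (num_perms c k m)" for c
    by (simp add: num_perms_def Int_def flip: of_nat_sum)
  have pred: "(\<Sum>\<sigma>\<in>?A. of_bool (Suc (des_E \<sigma>) = k \<and> even (\<sigma> ! 0) = c)) =
      (case k of 0 \<Rightarrow> 0 | Suc l \<Rightarrow> int (num_perms c l m))" for c
    by (cases k) (simp_all add: num_perms_def Int_def)
  have "{1..Suc m} = insert (Suc m) {1..m}" by auto
  then have "int (num_perms b k (Suc m)) = (\<Sum>\<sigma>\<in>?A. int (card {i. i \<le> m \<and>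
      des_E (insert_at i (Suc m) \<sigma>) = k \<and> even (insert_at i (Suc m) \<sigma> ! 0) = b}))"
    unfolding num_perms_def by (simp add: card_permutations_of_set_insert_at)
  then show ?thesis
    by (simp only: card_insertion_slots[OF _ assms] sum.distrib same pred
        flip: sum_distrib_left cong: sum.cong)
qed

section \<open>Solving the recurrence by products of binomial coefficients\<close>

lemma int_binomial_absorb:
  "(int k + 1) * int (n choose Suc k) = (int n - int k) * int (n choose k)"
proof (cases "k \<le> n")
  case True
  have "Suc k * (n choose Suc k) = (n - k) * (n choose k)"
    by (metis binomial_absorb_comp binomial_absorption)
  then have "int (Suc k * (n choose Suc k)) = int ((n - k) * (n choose k))" by (rule arg_cong)
  then show ?thesis using True by (simp add: of_nat_diff algebra_simps)
next
  \<comment> \<open>For \<open>k > n\<close> both binomial coefficients vanish, so the negative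
    factor \<open>int n - int k\<close> does no harm.\<close>
  case False
  then show ?thesis by (simp add: binomial_eq_0)
qed

text \<open>Both parities and all \<open>k\<close> are bundled, since the recurrence mixes them. The
  product of neighbouring binomial coefficients avoids the division by \<open>k + 1\<close>.\<close>

definition odd_closed_form :: "nat \<Rightarrow> bool" where
  "odd_closed_form n \<longleftrightarrow>
    (\<forall>k. int (num_perms False k (2 * n + 1)) = (int n + 1) * (fact n)\<^sup>2 * (int (n choose k))\<^sup>2) \<and>
    (\<forall>k. int (num_perms True k (2 * n + 1)) =
      (int n + 1) * (fact n)\<^sup>2 * int (n choose k) * int (n choose Suc k))"

text \<open>The intermediate stage: the recurrence lengthens words by one letter, so going from
  \<open>n\<close> to \<open>Suc n\<close> takes two steps.\<close>

definition even_closed_form :: "nat \<Rightarrow> bool" where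
  "even_closed_form n \<longleftrightarrow>
    (\<forall>k. int (num_perms False k (2 * n + 2)) =
      (int n + 1)\<^sup>2 * (fact n)\<^sup>2 * int (n choose k) * int (Suc n choose k)) \<and>
    (\<forall>k. int (num_perms True k (2 * n + 2)) =
      (int n + 1)\<^sup>2 * (fact n)\<^sup>2 * int (n choose k) * int (Suc n choose Suc k))"

lemma odd_closed_form_0: "odd_closed_form 0"
proof -
  have "{\<sigma>. \<sigma> = [Suc 0] \<and> des_E \<sigma> = k \<and> odd (\<sigma> ! 0)} = (if k = 0 then {[1]} else {})" for k
    by auto
  moreover have "{\<sigma>. \<sigma> = [Suc 0] \<and> des_E \<sigma> = k \<and> even (\<sigma> ! 0)} = {}" for k
    by auto
  ultimately show ?thesis
    by (auto simp: odd_closed_form_def num_perms_def permutations_of_set_singleton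
        binomial_eq_0_iff)
qed

lemma even_closed_form_if_odd:
  assumes "odd_closed_form n"
  shows "even_closed_form n"
proof -
  define f :: int where "f = (fact n)\<^sup>2"
  define c where "c k = int (n choose k)" for k
  have F: "int (num_perms False k (2 * n + 1)) = (int n + 1) * f * (c k)\<^sup>2"
    and T: "int (num_perms True k (2 * n + 1)) = (int n + 1) * f * c k * c (Suc k)" for k
    using assms by (simp_all add: odd_closed_form_def f_def c_def)
  have absorb: "(int k + 1) * c (Suc k) = (int n - int k) * c k" for k
    by (simp add: c_def int_binomial_absorb)
  have c0: "c 0 = 1" "c (Suc 0) = int n" by (simp_all add: c_def)
  have pascal: "int (Suc n choose Suc k) = c k + c (Suc k)" for k
    by (simp add: c_def)
  have halve: "(2 * n + 1) div 2 = n" "even (Suc (2 * n + 1)) = True"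
    "Suc (2 * n + 1) = 2 * n + 2" by simp_all
  note recF = num_perms_Suc[of "2 * n + 1" False, unfolded halve F T]
  note recT = num_perms_Suc[of "2 * n + 1" True, unfolded halve F T]
  have "int (num_perms False k (2 * n + 2)) = (int n + 1)\<^sup>2 * f * c k * int (Suc n choose k)" for k
  proof (cases k)
    case 0
    then show ?thesis
      using recF[of k] by (simp add: c0 power2_eq_square algebra_simps)
  next
    case (Suc l)
    show ?thesis
      \<comment> \<open>With \<open>k = Suc l\<close>, what remains is
        \<open>k * c k ^ 2 + (n + 1 - k) * c l ^ 2 = (n + 1) * c k * c l\<close> up to a common
        factor; absorption rewrites each square on the left as a multiple of
        \<open>c k * c l\<close>.\<close>
      using recF[of k] absorb[of l] unfolding Suc pascal by (simp, algebra)
  qed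
  moreover have "int (num_perms True k (2 * n + 2)) =
      (int n + 1)\<^sup>2 * f * c k * int (Suc n choose Suc k)" for k
  proof (cases k)
    case 0
    then show ?thesis
      using recT[of k] unfolding pascal by (simp add: c0 power2_eq_square algebra_simps)
  next
    case (Suc l)
    show ?thesis
      using recT[of k] absorb[of l] absorb[of "Suc l"] unfolding Suc pascal by (simp, algebra)
  qed
  ultimately show ?thesis
    unfolding even_closed_form_def f_def c_def by blast
qed

lemma odd_closed_form_Suc:
  assumes "even_closed_form n"
  shows "odd_closed_form (Suc n)"
proof -
  define f :: int where "f = (fact n)\<^sup>2"
  define c where "c k = int (n choose k)" for k
  define d where "d k = int (Suc n choose k)" for k
  have F: "int (num_perms False k (2 * n + 2)) = (int n + 1)\<^sup>2 * f * c k * d k"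
    and T: "int (num_perms True k (2 * n + 2)) = (int n + 1)\<^sup>2 * f * c k * d (Suc k)" for k
    using assms by (simp_all add: even_closed_form_def f_def c_def d_def)
  have absorb_c: "(int k + 1) * c (Suc k) = (int n - int k) * c k" for k
    by (simp add: c_def int_binomial_absorb)
  have absorb_d: "(int k + 1) * d (Suc k) = (int n + 1 - int k) * d k" for k
    using int_binomial_absorb[of k "Suc n"] by (simp add: d_def del: binomial_Suc_Suc)
  have c0: "c 0 = 1" "d 0 = 1" by (simp_all add: c_def d_def)
  have pascal: "d (Suc k) = c k + c (Suc k)" for k
    by (simp add: c_def d_def)
  have halve: "(2 * n + 2) div 2 = n + 1" "even (Suc (2 * n + 2)) = False"
    "Suc (2 * n + 2) = 2 * Suc n + 1" by simp_all
  note recF = num_perms_Suc[of "2 * n + 2" False, unfolded halve F T]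
  note recT = num_perms_Suc[of "2 * n + 2" True, unfolded halve F T]
  have fact: "(fact (Suc n))\<^sup>2 = (int n + 1)\<^sup>2 * f"
    by (simp add: f_def power_mult_distrib)
  have "int (num_perms False k (2 * Suc n + 1)) = (int n + 2) * ((int n + 1)\<^sup>2 * f) * (d k)\<^sup>2" for k
  proof (cases k)
    case 0
    then show ?thesis
      using recF[of k] by (simp add: c0 power2_eq_square algebra_simps)
  next
    case (Suc l)
    show ?thesis
      \<comment> \<open>Here the front slot contributes \<open>c k * d k + c l * d k\<close>, which
        Pascal's rule collapses to \<open>d k ^ 2\<close>.\<close>
      using recF[of k] absorb_c[of l] absorb_d[of l] pascal[of l]
      unfolding Suc by (simp, algebra)
  qed
  moreover have "int (num_perms True k (2 * Suc n + 1)) =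
      (int n + 2) * ((int n + 1)\<^sup>2 * f) * d k * d (Suc k)" for k
  proof (cases k)
    case 0
    then show ?thesis
      using recT[of k] by (simp add: c0 power2_eq_square algebra_simps)
  next
    case (Suc l)
    show ?thesis
      using recT[of k] absorb_c[of l] absorb_d[of "Suc l"] pascal[of l]
      unfolding Suc by (simp, algebra)
  qed
  ultimately show ?thesis
    unfolding odd_closed_form_def fact d_def by (simp add: add.commute)
qed

lemma odd_closed_form: "odd_closed_form n"
  by (induction n) (auto intro: odd_closed_form_0 odd_closed_form_Suc even_closed_form_if_odd)

text \<open>Both counts are read off from \<open>odd_closed_form\<close>; absorption then changes
  the shape of the binomial factors. The last formula lives in the reals, where its quotient is
  exact.\<close>

theorem theorem4p7:
  fixes n k :: nat
  assumes "n \<ge> 1" and "k \<le> n"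
  shows "P 0 k (2 * n + 1) = (k + 1) * (n choose k) * ((n + 1) choose (k + 1)) * (fact n)\<^sup>2
    \<and> (k + 1) * (n choose k) * ((n + 1) choose (k + 1)) * (fact n)\<^sup>2
        = (n + 1) * (n choose k)\<^sup>2 * (fact n :: nat)\<^sup>2
    \<and> real (P 1 k (2 * n + 1))
        = (real n + 1) * (real n - real k) / (real k + 1) * (real (n choose k))\<^sup>2 * (fact n)\<^sup>2"
proof -
  have "int (P 0 k (2 * n + 1)) = int ((n + 1) * (n choose k)\<^sup>2 * (fact n)\<^sup>2)"
    using odd_closed_form[of n] unfolding P_eq_num_perms
    by (simp add: odd_closed_form_def algebra_simps)
  then have P0: "P 0 k (2 * n + 1) = (n + 1) * (n choose k)\<^sup>2 * (fact n)\<^sup>2"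
    by (simp only: of_nat_eq_iff)
  have "(k + 1) * ((n + 1) choose (k + 1)) = (n + 1) * (n choose k)"
    using Suc_times_binomial[of k n] by (simp del: binomial_Suc_Suc)
  then have eq: "(k + 1) * (n choose k) * ((n + 1) choose (k + 1)) * (fact n)\<^sup>2
      = (n + 1) * (n choose k)\<^sup>2 * (fact n :: nat)\<^sup>2"
    by algebra
  have "int (P 1 k (2 * n + 1)) = int ((n + 1) * (fact n)\<^sup>2 * (n choose k) * (n choose Suc k))"
    using odd_closed_form[of n] unfolding P_eq_num_perms
    by (simp add: odd_closed_form_def algebra_simps)
  then have "P 1 k (2 * n + 1) = (n + 1) * (fact n)\<^sup>2 * (n choose k) * (n choose Suc k)"
    by (simp only: of_nat_eq_iff)
  then have P1: "real (P 1 k (2 * n + 1)) =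
      (real n + 1) * (fact n)\<^sup>2 * real (n choose k) * real (n choose Suc k)"
    by (simp add: algebra_simps)
  \<comment> \<open>Absorption is transferred from the integers, so \<open>n - k\<close> is a true
    difference, and is then divided by the positive \<open>k + 1\<close>.\<close>
  have "real_of_int ((int k + 1) * int (n choose Suc k)) =
      real_of_int ((int n - int k) * int (n choose k))"
    by (simp only: int_binomial_absorb)
  then have "real (n choose Suc k) = (real n - real k) / (real k + 1) * real (n choose k)"
    by (simp add: field_simps)
  then have "real (P 1 k (2 * n + 1))
        = (real n + 1) * (real n - real k) / (real k + 1) * (real (n choose k))\<^sup>2 * (fact n)\<^sup>2"
    unfolding P1 by (simp add: power2_eq_square)
  then show ?thesis using P0 eq by simp
qed

end
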